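(* Let $\mathcal{G}$ be a connected metric graph with vertex set $\mathsf{V}$, edge set $\mathsf{E}$ and edge lengths $(\ell_{\mathsf{e}})_{\mathsf{e}\in\mathsf{E}}$, and let $\alpha\in[0,\infty)^{\mathsf{V}}$ be not identically zero. Let $\tilde{\mathcal{G}}$ be the metric graph obtained from $\mathcal{G}$ by increasing the length of one edge, i.e. there exists $\mathsf{e}_0\in\mathsf{E}$ such that the edge lengths of $\tilde{\mathcal{G}}$ satisfy $\tilde{\ell}_{\mathsf{e}}=\ell_{\mathsf{e}}$ for $\mathsf{e}\neq\mathsf{e}_0$ and $\tilde{\ell}_{\mathsf{e}_0}>\ell_{\mathsf{e}_0}$. Then $T(\mathcal{G},\alpha)<T(\tilde{\mathcal{G}},\alpha)$.
   Context: A metric graph $\mathcal{G}$ is a finite collection of intervals glued together at their endpoints according to a finite combinatorial graph $(\mathsf{V},\mathsf{E})$ (loops and multiple edges allowed); each edge $\mathsf{e}\in\mathsf{E}$ is identified with $[0,\ell_{\mathsf{e}}]$, $\ell_{\mathsf{e}}\in(0,\infty)$. It is connected if any two points are joined by a continuous path. $\mathsf{E}_{\mathsf{v}}$ is the collection of edges incident to $\mathsf{v}$ (a loop at $\mathsf{v}$ counted twice, once for each endpoint), $u_{\mathsf{e}}$ is the restriction of $u$ to $\mathsf{e}$, and $\frac{\partial u_{\mathsf{e}}}{\partial n}(\mathsf{v})$ is the derivative of $u_{\mathsf{e}}$ at the endpoint $\mathsf{v}$ in the direction pointing into $\mathsf{v}$. For $\alpha\in\mathbb{R}^{\mathsf{V}}$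 (the strengths), the operator $-\Delta_{\mathcal{G},\alpha}$ in $L^2(\mathcal{G})$ acts as $u\mapsto -u''$ on each edge, on functions that are edgewise in $H^2(0,\ell_{\mathsf{e}})$, continuous at every vertex, and satisfy $\sum_{\mathsf{e}\in\mathsf{E}_{\mathsf{v}}}\frac{\partial u_{\mathsf{e}}}{\partial n}(\mathsf{v})+\alpha_{\mathsf{v}}u(\mathsf{v})=0$ for all $\mathsf{v}\in\mathsf{V}$. The torsion function of $(\mathcal{G},\alpha)$ is the unique solution $\upsilon$ of $-\Delta_{\mathcal{G},\alpha}\upsilon=1$ (it exists and is strictly positive when $\mathcal{G}$ is connected and $\alpha\in[0,\infty)^{\mathsf{V}}$ is not identically zero), and the torsional rigidity is $T(\mathcal{G},\alpha)=\int_{\mathcal{G}}\upsilon(x)\,\mathrm{d}x$. *)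

theory Defs
  imports "HOL-Analysis.Analysis" "Graph_Theory.Digraph"
begin

section \<open>Metric graphs\<close>

text \<open>
  A finite combinatorial graph, loops and multiple edges allowed, together with edge lengths.
  The orientation of an arc carries no mathematical content: it only fixes the identification
  of \<open>e\<close> with \<open>[0, len e]\<close>, in which \<open>tail G e\<close> corresponds to \<open>0\<close> and \<open>head G e\<close> to \<open>len e\<close>.
\<close>

locale metric_graph = fin_digraph G
  for G :: "('v, 'e) pre_digraph" +
  fixes len :: "'e \<Rightarrow> real"
  assumes len_pos: "e \<in> arcs G \<Longrightarrow> 0 < len e"

datatype ('v, 'e) gpoint = Vertex 'v | Inner 'e real

definition gpoints :: "('v, 'e) pre_digraph \<Rightarrow> ('e \<Rightarrow> real) \<Rightarrow> ('v, 'e) gpoint set" where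
  "gpoints G len = Vertex ` verts G \<union> {Inner e x | e x. e \<in> arcs G \<and> 0 < x \<and> x < len e}"

text \<open>The gluing map, restricted to one edge \<open>[0, len e]\<close>.\<close>

definition edge_point ::
  "('v, 'e) pre_digraph \<Rightarrow> ('e \<Rightarrow> real) \<Rightarrow> 'e \<Rightarrow> real \<Rightarrow> ('v, 'e) gpoint" where
  "edge_point G len e x =
     (if x = 0 then Vertex (tail G e)
      else if x = len e then Vertex (head G e)
      else Inner e x)"

text \<open>
  The quotient topology: the finest topology for which all maps \<^term>\<open>edge_point G len e\<close>
  on \<open>[0, len e]\<close> are continuous (isolated vertices are isolated points).
\<close>

definition gtopology ::
  "('v, 'e) pre_digraph \<Rightarrow> ('e \<Rightarrow> real) \<Rightarrow> ('v, 'e) gpoint topology" where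
  "gtopology G len = topology (\<lambda>U. U \<subseteq> gpoints G len \<and>
     (\<forall>e\<in>arcs G. openin (top_of_set {0..len e}) {x \<in> {0..len e}. edge_point G len e x \<in> U}))"

lemma openin_gtopology:
  "openin (gtopology G len) U \<longleftrightarrow> U \<subseteq> gpoints G len \<and>
     (\<forall>e\<in>arcs G. openin (top_of_set {0..len e}) {x \<in> {0..len e}. edge_point G len e x \<in> U})"
proof -
  let ?L = "\<lambda>U. U \<subseteq> gpoints G len \<and>
     (\<forall>e\<in>arcs G. openin (top_of_set {0..len e}) {x \<in> {0..len e}. edge_point G len e x \<in> U})"
  have "?L (S \<inter> T)" if "?L S" "?L T" for S T
  proof -
    have "openin (top_of_set {0..len e}) {x \<in> {0..len e}. edge_point G len e x \<in> S \<inter> T}"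
      if "e \<in> arcs G" for e
    proof -
      have "{x \<in> {0..len e}. edge_point G len e x \<in> S \<inter> T} =
          {x \<in> {0..len e}. edge_point G len e x \<in> S} \<inter> {x \<in> {0..len e}. edge_point G len e x \<in> T}"
        by auto
      then show ?thesis
        using \<open>?L S\<close> \<open>?L T\<close> that by (metis (no_types, lifting) openin_Int)
    qed
    then show ?thesis
      using that by blast
  qed
  moreover have "?L (\<Union>\<K>)" if "\<forall>K\<in>\<K>. ?L K" for \<K>
  proof -
    have "openin (top_of_set {0..len e}) {x \<in> {0..len e}. edge_point G len e x \<in> \<Union>\<K>}"
      if "e \<in> arcs G" for e
    proof -
      have "{x \<in> {0..len e}. edge_point G len e x \<in> \<Union>\<K>} =
          \<Union>((\<lambda>K. {x \<in> {0..len e}. edge_point G len e x \<in> K}) ` \<K>)"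
        by auto
      moreover have "openin (top_of_set {0..len e})
          (\<Union>((\<lambda>K. {x \<in> {0..len e}. edge_point G len e x \<in> K}) ` \<K>))"
        using \<open>\<forall>K\<in>\<K>. ?L K\<close> that by (intro openin_Union) auto
      ultimately show ?thesis
        by simp
    qed
    then show ?thesis
      using that by blast
  qed
  ultimately have "istopology ?L"
    unfolding istopology_def by blast
  then show ?thesis
    unfolding gtopology_def by (simp add: topology_inverse')
qed

lemma (in metric_graph) edge_point_in_gpoints:
  "e \<in> arcs G \<Longrightarrow> x \<in> {0..len e} \<Longrightarrow> edge_point G len e x \<in> gpoints G len"
  by (auto simp: edge_point_def gpoints_def)

lemma (in metric_graph) topspace_gtopology: "topspace (gtopology G len) = gpoints G len"
proof -
  have "openin (gtopology G len) (gpoints G len)"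
    unfolding openin_gtopology
  proof (intro conjI ballI subset_refl)
    fix e assume "e \<in> arcs G"
    then have "{x \<in> {0..len e}. edge_point G len e x \<in> gpoints G len} = {0..len e}"
      using edge_point_in_gpoints by blast
    then show "openin (top_of_set {0..len e})
        {x \<in> {0..len e}. edge_point G len e x \<in> gpoints G len}"
      by simp
  qed
  then show ?thesis
    by (meson openin_gtopology openin_subset openin_topspace subset_antisym)
qed

definition connected_mg :: "('v, 'e) pre_digraph \<Rightarrow> ('e \<Rightarrow> real) \<Rightarrow> bool" where
  "connected_mg G len \<longleftrightarrow> path_connected_space (gtopology G len)"

text \<open>The restriction \<open>u\<^sub>e\<close>, as a function on \<open>[0, len e]\<close>.\<close>

definition edge_fun ::
  "('v, 'e) pre_digraph \<Rightarrow> ('e \<Rightarrow> real) \<Rightarrow> (('v, 'e) gpoint \<Rightarrow> real) \<Rightarrow> 'e \<Rightarrow> real \<Rightarrow> real" where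
  "edge_fun G len u e x = u (edge_point G len e x)"


section \<open>The Sobolev space \<open>H\<^sup>2(0, l)\<close>\<close>

text \<open>
  The definition via weak derivatives, with \<open>C\<^sup>1\<close> test functions compactly supported in \<open>(0, l)\<close>.
  Elements are functions; no quotient by almost-everywhere equality is taken.
\<close>

definition L2 :: "real \<Rightarrow> (real \<Rightarrow> real) set" where
  "L2 l = {f \<in> borel_measurable (lebesgue_on {0<..<l}).
             integrable (lebesgue_on {0<..<l}) (\<lambda>x. (f x)\<^sup>2)}"

definition test_fun :: "real \<Rightarrow> (real \<Rightarrow> real) \<Rightarrow> bool" where
  "test_fun l \<phi> \<longleftrightarrow> \<phi> C1_differentiable_on UNIV \<and>
     (\<exists>K. compact K \<and> K \<subseteq> {0<..<l} \<and> (\<forall>x. x \<notin> K \<longrightarrow> \<phi> x = 0))"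

definition weak_deriv :: "real \<Rightarrow> (real \<Rightarrow> real) \<Rightarrow> (real \<Rightarrow> real) \<Rightarrow> bool" where
  "weak_deriv l f g \<longleftrightarrow> f \<in> L2 l \<and> g \<in> L2 l \<and>
     (\<forall>\<phi>. test_fun l \<phi> \<longrightarrow>
        (LINT x|lebesgue_on {0<..<l}. f x * deriv \<phi> x) =
        - (LINT x|lebesgue_on {0<..<l}. g x * \<phi> x))"

definition weak_deriv2 :: "real \<Rightarrow> (real \<Rightarrow> real) \<Rightarrow> (real \<Rightarrow> real) \<Rightarrow> bool" where
  "weak_deriv2 l f h \<longleftrightarrow> (\<exists>g. weak_deriv l f g \<and> weak_deriv l g h)"

definition H2 :: "real \<Rightarrow> (real \<Rightarrow> real) set" where
  "H2 l = {f. \<exists>h. weak_deriv2 l f h}"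


section \<open>The operator \<open>-\<Delta>\<^sub>G\<^sub>,\<^sub>\<alpha>\<close>\<close>

text \<open>
  The sum over the edges incident to \<open>v\<close> of the derivatives pointing into \<open>v\<close>. A loop at \<open>v\<close>
  occurs in both sums. The derivatives at the endpoints are one-sided; at the endpoint \<open>0\<close> the
  direction pointing into the vertex is the negative one.
\<close>

definition normal_deriv_sum ::
  "('v, 'e) pre_digraph \<Rightarrow> ('e \<Rightarrow> real) \<Rightarrow> (('v, 'e) gpoint \<Rightarrow> real) \<Rightarrow> 'v \<Rightarrow> real" where
  "normal_deriv_sum G len u v =
     (\<Sum>e\<in>{e \<in> arcs G. tail G e = v}.
        - vector_derivative (edge_fun G len u e) (at 0 within {0..len e})) +
     (\<Sum>e\<in>{e \<in> arcs G. head G e = v}.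
        vector_derivative (edge_fun G len u e) (at (len e) within {0..len e}))"

text \<open>
  Domain of the operator. A function that is edgewise in \<open>H\<^sup>2\<close> is represented by its edgewise
  continuous representative, so that edgewise continuity together with continuity at every
  vertex is continuity on the whole metric graph.
\<close>

definition laplacian_dom ::
  "('v, 'e) pre_digraph \<Rightarrow> ('e \<Rightarrow> real) \<Rightarrow> ('v \<Rightarrow> real) \<Rightarrow> (('v, 'e) gpoint \<Rightarrow> real) set" where
  "laplacian_dom G len \<alpha> =
     {u. continuous_map (gtopology G len) euclideanreal u \<and>
         (\<forall>e\<in>arcs G. edge_fun G len u e \<in> H2 (len e)) \<and>
         (\<forall>v\<in>verts G. normal_deriv_sum G len u v + \<alpha> v * u (Vertex v) = 0)}"

text \<open>
  \<open>u\<close> is in the domain and \<open>-\<Delta>\<^sub>G\<^sub>,\<^sub>\<alpha> u = f\<close> in \<open>L\<^sup>2(G)\<close>; weak derivatives are determined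
  only almost everywhere, so this is an equation almost everywhere on each edge.
\<close>

definition neg_laplacian_eq ::
  "('v, 'e) pre_digraph \<Rightarrow> ('e \<Rightarrow> real) \<Rightarrow> ('v \<Rightarrow> real) \<Rightarrow>
     (('v, 'e) gpoint \<Rightarrow> real) \<Rightarrow> (('v, 'e) gpoint \<Rightarrow> real) \<Rightarrow> bool" where
  "neg_laplacian_eq G len \<alpha> u f \<longleftrightarrow> u \<in> laplacian_dom G len \<alpha> \<and>
     (\<forall>e\<in>arcs G. weak_deriv2 (len e) (edge_fun G len u e) (\<lambda>x. - edge_fun G len f e x))"


section \<open>Torsion function and torsional rigidity\<close>

text \<open>
  Membership in \<^const>\<open>extensional\<close> only fixes the irrelevant values outside the metric graph,
  so that uniqueness holds literally.
\<close>

definition torsion_function ::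
  "('v, 'e) pre_digraph \<Rightarrow> ('e \<Rightarrow> real) \<Rightarrow> ('v \<Rightarrow> real) \<Rightarrow> ('v, 'e) gpoint \<Rightarrow> real" where
  "torsion_function G len \<alpha> =
     (THE u. u \<in> extensional (gpoints G len) \<and> neg_laplacian_eq G len \<alpha> u (\<lambda>_. 1))"

definition graph_integral ::
  "('v, 'e) pre_digraph \<Rightarrow> ('e \<Rightarrow> real) \<Rightarrow> (('v, 'e) gpoint \<Rightarrow> real) \<Rightarrow> real" where
  "graph_integral G len u =
     (\<Sum>e\<in>arcs G. LINT x|lebesgue_on {0..len e}. edge_fun G len u e x)"

definition torsional_rigidity ::
  "('v, 'e) pre_digraph \<Rightarrow> ('e \<Rightarrow> real) \<Rightarrow> ('v \<Rightarrow> real) \<Rightarrow> real" where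
  "torsional_rigidity G len \<alpha> = graph_integral G len (torsion_function G len \<alpha>)"

end

theory Submission
  imports Defs "Jordan_Normal_Form.Determinant"
begin

text \<open>
  On an edge of length \<open>l\<close> the torsion function is \<open>s + (t - s) x / l + x (l - x) / 2\<close>, where \<open>s\<close>
  and \<open>t\<close> are its values at the two endpoints. The vertex conditions therefore become a discrete
  problem for the vector \<open>f\<close> of vertex values, with the weak form \<open>E(f, g) = b(g)\<close> for all \<open>g\<close>, where
  \<open>E(f, f) = \<Sum>\<^sub>e (f(head e) - f(tail e))\<^sup>2 / l\<^sub>e + \<Sum>\<^sub>v \<alpha>\<^sub>v f(v)\<^sup>2\<close> and
  \<open>b(g) = \<Sum>\<^sub>e l\<^sub>e (g(tail e) + g(head e)) / 2\<close>. Connectedness and \<open>\<alpha> \<noteq> 0\<close> make \<open>E\<close> positive definite,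
  and integrating over the edges gives \<open>T = b(f) + \<Sum>\<^sub>e l\<^sub>e\<^sup>3 / 12\<close>. Moreover \<open>b(f)\<close> is the maximum of
  \<open>2 b(g) - E(g, g)\<close>. Lengthening an edge decreases \<open>E(g, g)\<close> and, for \<open>g \<ge> 0\<close>, increases \<open>b(g)\<close>;
  replacing \<open>f\<close> by \<open>\<bar>f\<bar>\<close> changes \<open>2 b - E\<close> in the right direction too. So \<open>\<bar>f\<bar>\<close> is a competitor for the
  longer graph showing that \<open>b(f)\<close> does not decrease, and the cubic term grows strictly.
\<close>

subsection \<open>Weak derivatives and test functions\<close>

lemma integrable_on_Ioo:
  fixes f :: "real \<Rightarrow> real"
  assumes "continuous_on {0..l} f"
  shows "integrable (lebesgue_on {0<..<l}) f"
proof -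
  have "set_integrable lebesgue {0<..<l} f"
    by (rule set_integrable_subset[OF absolutely_integrable_continuous_real[OF assms]]) auto
  then show ?thesis
    by (simp add: set_integrable_def integrable_restrict_space)
qed

lemma lebesgue_integral_Ioo:
  fixes f :: "real \<Rightarrow> real"
  assumes "continuous_on {0..l} f"
  shows "(LINT x|lebesgue_on {0<..<l}. f x) = integral {0..l} f"
  using lebesgue_integral_eq_integral[OF integrable_on_Ioo[OF assms]]
  by (simp add: integral_open_interval_real)

lemma continuous_imp_L2:
  assumes "continuous_on {0..l} f"
  shows "f \<in> L2 l"
  using integrable_on_Ioo[OF assms] integrable_on_Ioo[OF continuous_on_power[OF assms, of 2]]
  by (simp add: L2_def)

lemma test_funD:
  assumes "test_fun l \<phi>"
  shows "(\<phi> has_real_derivative deriv \<phi> x) (at x)"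
    and "continuous_on S \<phi>" "continuous_on S (deriv \<phi>)"
    and "x \<notin> {0<..<l} \<Longrightarrow> \<phi> x = 0"
proof -
  have C1: "\<phi> C1_differentiable_on UNIV"
    using assms by (simp add: test_fun_def)
  then obtain D where D: "\<And>x. (\<phi> has_vector_derivative D x) (at x)" "continuous_on UNIV D"
    unfolding C1_differentiable_on_def by auto
  then have "deriv \<phi> = D"
    by (simp add: DERIV_imp_deriv has_real_derivative_iff_has_vector_derivative fun_eq_iff)
  with D show "(\<phi> has_real_derivative deriv \<phi> x) (at x)" "continuous_on S (deriv \<phi>)"
    by (auto simp: has_real_derivative_iff_has_vector_derivative intro: continuous_on_subset)
  show "continuous_on S \<phi>"
    using D(1) by (meson continuous_at_imp_continuous_on has_vector_derivative_continuous)
  show "x \<notin> {0<..<l} \<Longrightarrow> \<phi> x = 0"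
    using assms unfolding test_fun_def by blast
qed

lemma test_funI:
  assumes "\<And>x. (\<phi> has_real_derivative \<psi> x) (at x)" "continuous_on UNIV \<psi>"
    and "0 < a" "b < l" "\<And>x. x \<notin> {a..b} \<Longrightarrow> \<phi> x = 0"
  shows "test_fun l \<phi>"
  unfolding test_fun_def C1_differentiable_on_def
proof (intro conjI exI)
  show "compact {a..b}" "{a..b} \<subseteq> {0<..<l}" "\<forall>x. x \<notin> {a..b} \<longrightarrow> \<phi> x = 0"
    using assms by auto
  show "\<forall>x\<in>UNIV. (\<phi> has_vector_derivative \<psi> x) (at x)" "continuous_on UNIV \<psi>"
    using assms by (auto simp: has_real_derivative_iff_has_vector_derivative)
qed

text \<open>Integration by parts: the derivative of \<open>F * \<phi>\<close> integrates to the
  boundary terms, which vanish because \<open>\<phi>\<close> has compact support in the open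
  interval.\<close>

lemma weak_derivI:
  assumes l: "0 \<le> l" and F: "continuous_on {0..l} F" and f: "continuous_on {0..l} f"
    and D: "\<And>x. x \<in> {0<..<l} \<Longrightarrow> (F has_real_derivative f x) (at x)"
  shows "weak_deriv l F f"
  unfolding weak_deriv_def
proof (intro conjI allI impI)
  show "F \<in> L2 l" "f \<in> L2 l"
    using F f by (auto intro: continuous_imp_L2)
  fix \<phi> assume \<phi>: "test_fun l \<phi>"
  note [continuous_intros] = test_funD(2,3)[OF \<phi>] F f
  have "((\<lambda>x. F x * deriv \<phi> x + f x * \<phi> x) has_integral (F l * \<phi> l - F 0 * \<phi> 0)) {0..l}"
  proof (rule fundamental_theorem_of_calculus_interior[OF l])
    show "continuous_on {0..l} (\<lambda>x. F x * \<phi> x)"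
      by (intro continuous_intros)
    fix x assume "x \<in> {0<..<l}"
    then show "((\<lambda>x. F x * \<phi> x) has_vector_derivative F x * deriv \<phi> x + f x * \<phi> x) (at x)"
      unfolding has_real_derivative_iff_has_vector_derivative[symmetric]
      by (auto intro!: derivative_eq_intros D test_funD(1)[OF \<phi>])
  qed
  moreover have "\<phi> 0 = 0" "\<phi> l = 0"
    using test_funD(4)[OF \<phi>] by auto
  ultimately have "integral {0..l} (\<lambda>x. F x * deriv \<phi> x + f x * \<phi> x) = 0"
    by (simp add: integral_unique)
  moreover have "integral {0..l} (\<lambda>x. F x * deriv \<phi> x + f x * \<phi> x) =
      integral {0..l} (\<lambda>x. F x * deriv \<phi> x) + integral {0..l} (\<lambda>x. f x * \<phi> x)"
    by (intro integral_add integrable_continuous_real continuous_intros)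
  ultimately show "(LINT x|lebesgue_on {0<..<l}. F x * deriv \<phi> x) =
      - (LINT x|lebesgue_on {0<..<l}. f x * \<phi> x)"
    using lebesgue_integral_Ioo[of l "\<lambda>x. F x * deriv \<phi> x"] lebesgue_integral_Ioo[of l "\<lambda>x. f x * \<phi> x"]
    by (simp add: continuous_on_mult F f test_funD(2,3)[OF \<phi>])
qed

lemma weak_deriv_cong:
  assumes "\<And>x. x \<in> {0<..<l} \<Longrightarrow> f x = f' x" "\<And>x. x \<in> {0<..<l} \<Longrightarrow> g x = g' x"
  shows "weak_deriv l f g \<longleftrightarrow> weak_deriv l f' g'"
proof -
  have L2: "h \<in> L2 l \<longleftrightarrow> h' \<in> L2 l" if "\<And>x. x \<in> {0<..<l} \<Longrightarrow> h x = h' x" for h h' :: "real \<Rightarrow> real"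
    unfolding L2_def mem_Collect_eq using that
    by (intro arg_cong2[where f = "(\<and>)"] measurable_cong Bochner_Integration.integrable_cong) auto
  have I: "(LINT x|lebesgue_on {0<..<l}. h x * k x) = (LINT x|lebesgue_on {0<..<l}. h' x * k x)"
    if "\<And>x. x \<in> {0<..<l} \<Longrightarrow> h x = h' x" for h h' k :: "real \<Rightarrow> real"
    using that by (intro Bochner_Integration.integral_cong) auto
  show ?thesis
    unfolding weak_deriv_def
    using L2[of f f'] L2[of g g'] I[of f f'] I[of g g'] assms by simp
qed

lemma weak_deriv2_cong:
  assumes "\<And>x. x \<in> {0<..<l} \<Longrightarrow> f x = f' x" "\<And>x. x \<in> {0<..<l} \<Longrightarrow> h x = h' x"
  shows "weak_deriv2 l f h \<longleftrightarrow> weak_deriv2 l f' h'"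
  unfolding weak_deriv2_def using weak_deriv_cong[OF assms(1) refl] weak_deriv_cong[OF refl assms(2)]
  by simp

lemma weak_deriv2_quadratic:
  assumes "0 \<le> l"
  shows "weak_deriv2 l (\<lambda>x. a + b * x - x\<^sup>2 / 2) (\<lambda>x. - 1)"
  unfolding weak_deriv2_def
proof (intro exI conjI)
  have D: "((\<lambda>x. a + b * x - x\<^sup>2 / 2) has_real_derivative b - x) (at x)"
    "((\<lambda>x. b - x) has_real_derivative - 1) (at x)" for x
    by (auto intro!: derivative_eq_intros)
  show "weak_deriv l (\<lambda>x. a + b * x - x\<^sup>2 / 2) (\<lambda>x. b - x)" "weak_deriv l (\<lambda>x. b - x) (\<lambda>x. - 1)"
    by (intro weak_derivI[OF assms] D continuous_intros; simp)+
qed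

text \<open>Two integrations by parts eliminate the intermediate weak derivative, and the two signs
  cancel. Test functions are only C1 here, hence the separate assumption on
  \<open>deriv \<phi>\<close>.\<close>

lemma weak_deriv2_test:
  assumes "weak_deriv2 l f h" "test_fun l \<phi>" "test_fun l (deriv \<phi>)"
  shows "(LINT x|lebesgue_on {0<..<l}. f x * deriv (deriv \<phi>) x) =
    (LINT x|lebesgue_on {0<..<l}. h x * \<phi> x)"
  using assms unfolding weak_deriv2_def weak_deriv_def by auto

section \<open>Test functions with prescribed second derivative, and regularity of weak
  solutions\<close>

lemma compactly_supported_antiderivative:
  fixes \<psi> :: "real \<Rightarrow> real"
  assumes ab: "a \<le> b" and cont: "continuous_on UNIV \<psi>" and supp: "\<And>x. x \<notin> {a<..<b} \<Longrightarrow> \<psi> x = 0"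
    and int: "(\<psi> has_integral 0) {a..b}"
  obtains P where "\<And>x. (P has_real_derivative \<psi> x) (at x)" "\<And>x. x \<notin> {a<..<b} \<Longrightarrow> P x = 0"
proof -
  have "isCont \<psi> x" for x
    using cont by (simp add: continuous_on_eq_continuous_at)
  then obtain F where F: "\<And>x. (F has_vector_derivative \<psi> x) (at x)"
    using einterval_antiderivative[of "- \<infinity>" "\<infinity>" \<psi>] by auto
  have FTC: "(\<psi> has_integral F y - F x) {x..y}" if "x \<le> y" for x y
    by (rule fundamental_theorem_of_calculus[OF that has_vector_derivative_at_within[OF F]])
  \<comment> \<open>Subtracting \<open>F a\<close> makes the antiderivative vanish left of
    \<open>a\<close>, where \<open>\<psi>\<close> is zero. Right of \<open>b\<close> it equals the
    total integral of \<open>\<psi>\<close>, which is zero as well.\<close>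
  show thesis
  proof
    show "((\<lambda>x. F x - F a) has_real_derivative \<psi> x) (at x)" for x
      using F[of x] unfolding has_real_derivative_iff_has_vector_derivative[symmetric]
      by (auto intro!: derivative_eq_intros)
    fix x assume "x \<notin> {a<..<b}"
    then consider "x \<le> a" | "b \<le> x" by force
    then show "F x - F a = 0"
    proof cases
      case 1
      have "(\<psi> has_integral 0) {x..a}"
        by (rule has_integral_is_0) (use supp in auto)
      then have "F a - F x = 0"
        using FTC[OF 1] by (rule has_integral_unique[symmetric])
      then show ?thesis by simp
    next
      case 2
      have "(\<psi> has_integral 0) {b..x}"
        by (rule has_integral_is_0) (use supp in auto)
      then have "F x - F b = 0"
        using FTC[OF 2] by (rule has_integral_unique[symmetric])
      moreover have "F b - F a = 0"
        using int FTC[OF ab] by (rule has_integral_unique[symmetric])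
      ultimately show ?thesis by simp
    qed
  qed
qed

text \<open>The preceding lemma is applied twice. The second application needs mean zero for the
  first antiderivative \<open>P\<close>; integrating the derivative of \<open>x * P x\<close> shows
  that this mean is minus the first moment of \<open>\<psi>\<close>.\<close>

lemma second_antiderivative_test_fun:
  fixes \<psi> :: "real \<Rightarrow> real"
  assumes ab: "0 < a" "a \<le> b" "b < l"
    and cont: "continuous_on UNIV \<psi>" and supp: "\<And>x. x \<notin> {a<..<b} \<Longrightarrow> \<psi> x = 0"
    and int0: "(\<psi> has_integral 0) {a..b}" and int1: "((\<lambda>x. x * \<psi> x) has_integral 0) {a..b}"
  obtains \<phi> where "test_fun l \<phi>" "test_fun l (deriv \<phi>)" "deriv (deriv \<phi>) = \<psi>"
proof -
  obtain P where P: "\<And>x. (P has_real_derivative \<psi> x) (at x)" "\<And>x. x \<notin> {a<..<b} \<Longrightarrow> P x = 0"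
    using compactly_supported_antiderivative[OF ab(2) cont supp int0] by metis
  have contP: "continuous_on UNIV P"
    by (meson P(1) DERIV_continuous continuous_at_imp_continuous_on)
  have "((\<lambda>x. P x + x * \<psi> x) has_integral (b * P b - a * P a)) {a..b}"
    by (rule fundamental_theorem_of_calculus[OF ab(2)])
      (auto intro!: derivative_eq_intros P(1) has_field_derivative_at_within[OF P(1)]
        simp: has_real_derivative_iff_has_vector_derivative[symmetric])
  from has_integral_diff[OF this int1] have "(P has_integral 0) {a..b}"
    by (simp add: P(2))
  then obtain Q where Q: "\<And>x. (Q has_real_derivative P x) (at x)" "\<And>x. x \<notin> {a<..<b} \<Longrightarrow> Q x = 0"
    using compactly_supported_antiderivative[OF ab(2) contP P(2)] by metis
  have "deriv Q = P" "deriv P = \<psi>"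
    using P(1) Q(1) by (auto intro: DERIV_imp_deriv)
  moreover have "test_fun l Q" "test_fun l P"
    using P Q contP cont ab by (auto intro!: test_funI[of _ _ a b])
  ultimately show thesis
    using that by metis
qed

text \<open>
  Since \<open>w(x) = u(x) + x\<^sup>2 / 2\<close> satisfies \<open>w'' = 0\<close> weakly, it is orthogonal to every continuous \<open>\<psi>\<close>
  supported in \<open>[a, b]\<close> whose moments of order 0 and 1 vanish, such \<open>\<psi>\<close> being second derivatives of
  test functions. Take \<open>\<psi> = \<eta> r\<close> with the weight \<open>\<eta>(x) = (x - a) (b - x)\<close> and \<open>r = w - p\<close>, \<open>p\<close> the
  \<open>\<eta>\<close>-weighted least squares affine fit of \<open>w\<close>; then \<open>\<integral> \<eta> r\<^sup>2 = \<integral> w \<psi> - \<integral> p \<psi> = 0\<close>.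
\<close>

lemma weak_deriv2_imp_quadratic_inner:
  fixes u :: "real \<Rightarrow> real"
  assumes cont: "continuous_on {0..l} u" and weak: "weak_deriv2 l u (\<lambda>x. - 1)"
    and ab: "0 < a" "a < b" "b < l"
  obtains c d where "\<And>x. x \<in> {a<..<b} \<Longrightarrow> u x + x\<^sup>2 / 2 = c + d * x"
proof -
  define m where "m = (a + b) / 2"
  define h where "h = (b - a) / 2"
  have h: "0 < h" and a: "a = m - h" and b: "b = m + h"
    using ab by (auto simp: m_def h_def field_simps)
  \<comment> \<open>Clamping the argument of \<open>u\<close> to \<open>{a..b}\<close> and
    truncating \<open>\<eta>\<close> at zero gives functions that are continuous on the whole line,
    as test functions require. On \<open>{a..b}\<close> they agree with \<open>u t + t^2 / 2\<close>
    and \<open>(t - a) * (b - t)\<close>.\<close>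
  define W where "W t = u (max a (min b t)) + t\<^sup>2 / 2" for t
  define \<eta> where "\<eta> t = max 0 ((t - a) * (b - t))" for t
  have \<eta>_in: "\<eta> t = h\<^sup>2 - (t - m)\<^sup>2" if "t \<in> {a..b}" for t
  proof -
    have "0 \<le> (t - a) * (b - t)"
      using that by simp
    then have "\<eta> t = (t - a) * (b - t)"
      by (simp add: \<eta>_def)
    then show ?thesis
      by (simp add: a b power2_eq_square algebra_simps)
  qed
  have \<eta>_pos: "0 < \<eta> t" if "t \<in> {a<..<b}" for t
    using that by (simp add: \<eta>_def less_max_iff_disj)
  have \<eta>_nonneg: "0 \<le> \<eta> t" for t
    by (simp add: \<eta>_def)
  have \<eta>_out: "\<eta> t = 0" if "t \<notin> {a<..<b}" for t
  proof -
    have "(t - a) * (b - t) \<le> 0"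
      using that ab by (auto simp: mult_le_0_iff)
    then show ?thesis by (simp add: \<eta>_def)
  qed
  have cont_\<eta>: "continuous_on S \<eta>" for S
    unfolding \<eta>_def by (intro continuous_intros)
  have cont_W: "continuous_on S W" for S
    unfolding W_def
    by (intro continuous_intros continuous_on_compose2[OF cont]) (use ab in auto)

  \<comment> \<open>Since \<open>\<eta>\<close> is symmetric about the midpoint \<open>m\<close>,
    the functions 1 and \<open>t - m\<close> are orthogonal for this weight (\<open>M1\<close>);
    \<open>M0\<close> and \<open>M2\<close> are their squared norms. The affine fit therefore
    decouples into the two quotients \<open>c\<close> and \<open>d\<close> below.\<close>
  have M0: "(\<eta> has_integral 4 * h ^ 3 / 3) {a..b}"
  proof -
    have "((\<lambda>t. h\<^sup>2 - (t - m)\<^sup>2) has_integral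
       (h\<^sup>2 * (b - m) - (b - m) ^ 3 / 3) - (h\<^sup>2 * (a - m) - (a - m) ^ 3 / 3)) {a..b}"
      by (rule fundamental_theorem_of_calculus)
        (use ab in \<open>auto intro!: derivative_eq_intros
           simp: has_real_derivative_iff_has_vector_derivative[symmetric]\<close>)
    then have "((\<lambda>t. h\<^sup>2 - (t - m)\<^sup>2) has_integral 4 * h ^ 3 / 3) {a..b}"
      by (simp add: a b power2_eq_square power3_eq_cube mult.assoc)
    then show ?thesis
      by (rule has_integral_eq[rotated]) (simp add: \<eta>_in)
  qed
  have M1: "((\<lambda>t. \<eta> t * (t - m)) has_integral 0) {a..b}"
  proof -
    have "((\<lambda>t. (h\<^sup>2 - (t - m)\<^sup>2) * (t - m)) has_integral
       (h\<^sup>2 * (b - m)\<^sup>2 / 2 - (b - m) ^ 4 / 4) - (h\<^sup>2 * (a - m)\<^sup>2 / 2 - (a - m) ^ 4 / 4)) {a..b}"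
      by (rule fundamental_theorem_of_calculus)
        (use ab in \<open>auto intro!: derivative_eq_intros
           simp: has_real_derivative_iff_has_vector_derivative[symmetric]
             power2_eq_square power3_eq_cube field_simps\<close>)
    then have "((\<lambda>t. (h\<^sup>2 - (t - m)\<^sup>2) * (t - m)) has_integral 0) {a..b}"
      by (simp add: a b)
    then show ?thesis
      by (rule has_integral_eq[rotated]) (simp add: \<eta>_in)
  qed
  have M2: "((\<lambda>t. \<eta> t * (t - m)\<^sup>2) has_integral 4 * h ^ 5 / 15) {a..b}"
  proof -
    have "((\<lambda>t. (h\<^sup>2 - (t - m)\<^sup>2) * (t - m)\<^sup>2) has_integral
       (h\<^sup>2 * (b - m) ^ 3 / 3 - (b - m) ^ 5 / 5) - (h\<^sup>2 * (a - m) ^ 3 / 3 - (a - m) ^ 5 / 5)) {a..b}"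
      by (rule fundamental_theorem_of_calculus)
        (use ab in \<open>auto intro!: derivative_eq_intros
           simp: has_real_derivative_iff_has_vector_derivative[symmetric]
             power2_eq_square eval_nat_numeral field_simps\<close>)
    then have "((\<lambda>t. (h\<^sup>2 - (t - m)\<^sup>2) * (t - m)\<^sup>2) has_integral 4 * h ^ 5 / 15) {a..b}"
      by (simp add: a b eval_nat_numeral)
    then show ?thesis
      by (rule has_integral_eq[rotated]) (simp add: \<eta>_in)
  qed

  define I0 where "I0 = integral {a..b} (\<lambda>t. \<eta> t * W t)"
  define I1 where "I1 = integral {a..b} (\<lambda>t. \<eta> t * W t * (t - m))"
  have I0: "((\<lambda>t. \<eta> t * W t) has_integral I0) {a..b}"
    and I1: "((\<lambda>t. \<eta> t * W t * (t - m)) has_integral I1) {a..b}"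
    unfolding I0_def I1_def
    by (intro integrable_integral integrable_continuous_real continuous_intros cont_W cont_\<eta>)+
  define c where "c = I0 / (4 * h ^ 3 / 3)"
  define d where "d = I1 / (4 * h ^ 5 / 15)"
  define r where "r t = W t - c - d * (t - m)" for t
  define \<psi> where "\<psi> t = \<eta> t * r t" for t
  have cont_r: "continuous_on S r" and cont_\<psi>: "continuous_on S \<psi>" for S
    unfolding r_def \<psi>_def by (intro continuous_intros cont_W cont_\<eta>)+
  have supp: "\<psi> t = 0" if "t \<notin> {a<..<b}" for t
    using that by (simp add: \<psi>_def \<eta>_out)
  have int0: "(\<psi> has_integral 0) {a..b}"
  proof -
    have "((\<lambda>t. \<eta> t * W t - c * \<eta> t - d * (\<eta> t * (t - m))) has_integral
        I0 - c * (4 * h ^ 3 / 3) - d * 0) {a..b}"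
      by (intro has_integral_diff has_integral_mult_right I0 M0 M1)
    moreover have "c * (4 * h ^ 3 / 3) = I0"
      using h by (simp add: c_def)
    moreover have "(\<lambda>t. \<eta> t * W t - c * \<eta> t - d * (\<eta> t * (t - m))) = \<psi>"
      by (simp add: fun_eq_iff \<psi>_def r_def algebra_simps)
    ultimately show ?thesis by simp
  qed
  have int1: "((\<lambda>t. (t - m) * \<psi> t) has_integral 0) {a..b}"
  proof -
    have "((\<lambda>t. \<eta> t * W t * (t - m) - c * (\<eta> t * (t - m)) - d * (\<eta> t * (t - m)\<^sup>2)) has_integral
        I1 - c * 0 - d * (4 * h ^ 5 / 15)) {a..b}"
      by (intro has_integral_diff has_integral_mult_right I1 M1 M2)
    moreover have "d * (4 * h ^ 5 / 15) = I1"
      using h by (simp add: d_def)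
    moreover have "(\<lambda>t. \<eta> t * W t * (t - m) - c * (\<eta> t * (t - m)) - d * (\<eta> t * (t - m)\<^sup>2)) =
        (\<lambda>t. (t - m) * \<psi> t)"
      by (simp add: fun_eq_iff \<psi>_def r_def algebra_simps power2_eq_square)
    ultimately show ?thesis by simp
  qed
  \<comment> \<open>The antiderivative lemma asks for the moment about 0. As the moment of order 0
    vanishes, the base point can be moved from \<open>m\<close> to 0.\<close>
  have int1': "((\<lambda>t. t * \<psi> t) has_integral 0) {a..b}"
    using has_integral_add[OF int1 has_integral_mult_right[OF int0, of m]]
    by (simp add: algebra_simps)
  obtain \<phi> where \<phi>: "test_fun l \<phi>" "test_fun l (deriv \<phi>)" "deriv (deriv \<phi>) = \<psi>"
    using second_antiderivative_test_fun[OF ab(1) less_imp_le[OF ab(2)] ab(3) cont_\<psi> supp int0 int1']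
    by metis
  \<comment> \<open>The function \<open>- (x^2 / 2)\<close> solves the same weak equation as
    \<open>u\<close>. Testing both with \<open>\<phi>\<close> cancels the right-hand sides and
    leaves the orthogonality of \<open>u x + x^2 / 2\<close> to \<open>\<psi>\<close>.\<close>
  have quad: "weak_deriv2 l (\<lambda>x. - (x\<^sup>2 / 2)) (\<lambda>x. - 1)"
    using weak_deriv2_quadratic[of l 0 0] ab by simp
  have "(LINT x|lebesgue_on {0<..<l}. u x * \<psi> x) =
      (LINT x|lebesgue_on {0<..<l}. - (x\<^sup>2 / 2) * \<psi> x)"
    using weak_deriv2_test[OF weak \<phi>(1,2)] weak_deriv2_test[OF quad \<phi>(1,2)] \<phi>(3) by simp
  then have "integral {0..l} (\<lambda>x. u x * \<psi> x) = integral {0..l} (\<lambda>x. - (x\<^sup>2 / 2) * \<psi> x)"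
    using lebesgue_integral_Ioo[of l "\<lambda>x. u x * \<psi> x"]
      lebesgue_integral_Ioo[of l "\<lambda>x. - (x\<^sup>2 / 2) * \<psi> x"]
    by (simp add: continuous_on_mult continuous_intros cont cont_\<psi>)
  moreover have "integral {0..l} (\<lambda>x. u x * \<psi> x - (- (x\<^sup>2 / 2) * \<psi> x)) =
      integral {0..l} (\<lambda>x. u x * \<psi> x) - integral {0..l} (\<lambda>x. - (x\<^sup>2 / 2) * \<psi> x)"
    by (intro integral_diff integrable_continuous_real continuous_intros cont cont_\<psi>) simp
  ultimately have "integral {0..l} (\<lambda>x. u x * \<psi> x - (- (x\<^sup>2 / 2) * \<psi> x)) = 0"
    by simp
  moreover have "u x * \<psi> x - (- (x\<^sup>2 / 2) * \<psi> x) = W x * \<psi> x" for x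
  proof (cases "x \<in> {a<..<b}")
    case True
    then show ?thesis by (simp add: W_def algebra_simps)
  qed (simp add: supp)
  ultimately have "integral {0..l} (\<lambda>x. W x * \<psi> x) = 0"
    by simp
  moreover have W\<psi>: "((\<lambda>x. W x * \<psi> x) has_integral integral {a..b} (\<lambda>x. W x * \<psi> x)) {a..b}"
    by (intro integrable_integral integrable_continuous_real continuous_on_mult cont_W cont_\<psi>)
  moreover have "((\<lambda>x. W x * \<psi> x) has_integral integral {a..b} (\<lambda>x. W x * \<psi> x)) {0..l}"
    using W\<psi> by (rule has_integral_on_superset) (use ab supp in auto)
  ultimately have "integral {a..b} (\<lambda>x. W x * \<psi> x) = 0"
    using integral_unique by metis
  with W\<psi> have "((\<lambda>x. W x * \<psi> x) has_integral 0) {a..b}"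
    by metis
  from has_integral_diff[OF has_integral_diff[OF this has_integral_mult_right[OF int0, of c]]
      has_integral_mult_right[OF int1, of d]]
  have "((\<lambda>x. W x * \<psi> x - c * \<psi> x - d * ((x - m) * \<psi> x)) has_integral 0) {a..b}"
    by simp
  moreover have "W x * \<psi> x - c * \<psi> x - d * ((x - m) * \<psi> x) = \<eta> x * (r x)\<^sup>2" for x
  proof -
    have "W x * \<psi> x - c * \<psi> x - d * ((x - m) * \<psi> x) = r x * \<psi> x"
      by (simp add: r_def algebra_simps)
    then show ?thesis
      by (simp add: \<psi>_def power2_eq_square)
  qed
  ultimately have "((\<lambda>x. \<eta> x * (r x)\<^sup>2) has_integral 0) {a..b}"
    by simp
  moreover have "continuous_on {a..b} (\<lambda>x. \<eta> x * (r x)\<^sup>2)"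
    by (intro continuous_intros cont_\<eta> cont_r)
  ultimately have zero: "\<eta> x * (r x)\<^sup>2 = 0" if "x \<in> {a..b}" for x
    using has_integral_0_cbox_imp_0[of a b "\<lambda>x. \<eta> x * (r x)\<^sup>2" x] that ab \<eta>_nonneg by simp
  show thesis
  proof
    fix x assume x: "x \<in> {a<..<b}"
    then have "r x = 0"
      using zero[of x] \<eta>_pos[of x] by auto
    with x show "u x + x\<^sup>2 / 2 = (c - d * m) + d * x"
      by (simp add: r_def W_def algebra_simps)
  qed
qed

text \<open>The inner lemma yields coefficients that may depend on the subinterval. The values at
  \<open>l / 3\<close> and \<open>2 * l / 3\<close> pin them down, and continuity carries the
  formula to the endpoints.\<close>

lemma weak_deriv2_imp_quadratic:
  fixes u :: "real \<Rightarrow> real"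
  assumes l: "0 < l" and cont: "continuous_on {0..l} u" and weak: "weak_deriv2 l u (\<lambda>x. - 1)"
    and x: "x \<in> {0..l}"
  shows "u x = u 0 + (u l - u 0) / l * x + x * (l - x) / 2"
proof -
  define w where "w x = u x + x\<^sup>2 / 2" for x
  have cont_w: "continuous_on {0..l} w"
    unfolding w_def by (intro continuous_intros cont) simp
  define d where "d = (w (2 * l / 3) - w (l / 3)) / (l / 3)"
  define c where "c = w (l / 3) - d * (l / 3)"
  have inner: "w x - d * x = c" if "x \<in> {0<..<l}" for x
  proof -
    \<comment> \<open>Each bound lies halfway between an end of the interval and the nearest of the
      points \<open>x\<close>, \<open>l / 3\<close>, \<open>2 * l / 3\<close>, so all three are
      inside while \<open>a\<close> and \<open>b\<close> stay away from 0 and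
      \<open>l\<close>.\<close>
    define a b where "a = min x (l / 3) / 2" and "b = (max x (2 * l / 3) + l) / 2"
    have ab: "0 < a" "a < b" "b < l" "x \<in> {a<..<b}" "l / 3 \<in> {a<..<b}" "2 * l / 3 \<in> {a<..<b}"
      using that l by (auto simp: a_def b_def min_def max_def)
    obtain c' d' where *: "\<And>x. x \<in> {a<..<b} \<Longrightarrow> w x = c' + d' * x"
      using weak_deriv2_imp_quadratic_inner[OF cont weak ab(1-3)] unfolding w_def by metis
    have "d = d'"
      unfolding d_def *[OF ab(5)] *[OF ab(6)] using l by (simp add: field_simps)
    moreover from this have "c = c'"
      unfolding c_def *[OF ab(5)] by simp
    ultimately show ?thesis
      using *[OF ab(4)] by simp
  qed
  have "w x - d * x = c" if "x \<in> {0..l}" for x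
  proof -
    have cl: "closure {0<..<l} = {0..l}"
      using l by simp
    have "continuous_on (closure {0<..<l}) (\<lambda>x. w x - d * x)"
      unfolding cl by (intro continuous_intros cont_w)
    from continuous_constant_on_closure[OF this inner] that show ?thesis
      by (simp add: cl)
  qed
  from this[of x] this[of 0] this[of l] x l
  have e: "u x = c + d * x - x\<^sup>2 / 2" "u 0 = c" "u l = c + d * l - l\<^sup>2 / 2"
    by (simp_all add: w_def)
  with l have slope: "(u l - u 0) / l = d - l / 2"
    by (simp add: field_simps power2_eq_square)
  show ?thesis
    unfolding slope unfolding e(1,2) by (simp add: field_simps power2_eq_square)
qed

section \<open>Square linear systems indexed by a finite set\<close>

lemma linear_system_solvable:
  fixes A :: "'v \<Rightarrow> 'v \<Rightarrow> real" and c :: "'v \<Rightarrow> real"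
  assumes V: "finite V"
    and inj: "\<And>f. (\<And>v. v \<in> V \<Longrightarrow> (\<Sum>w\<in>V. A v w * f w) = 0) \<Longrightarrow> \<forall>v\<in>V. f v = 0"
  obtains f where "\<And>v. v \<in> V \<Longrightarrow> (\<Sum>w\<in>V. A v w * f w) = c v"
proof -
  define n where "n = card V"
  obtain h where h: "bij_betw h {0..<n} V"
    using ex_bij_betw_nat_finite[OF V] unfolding n_def by blast
  define k where "k = inv_into {0..<n} h"
  have kh: "k (h i) = i" if "i < n" for i
    using h that unfolding k_def by (simp add: bij_betw_inv_into_left)
  have hk: "h (k v) = v" "k v < n" if "v \<in> V" for v
    using bij_betw_inv_into_right[OF h that] bij_betwE[OF bij_betw_inv_into[OF h]] that
    unfolding k_def by auto
  define M where "M = mat n n (\<lambda>(i, j). A (h i) (h j))"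
  have M: "M \<in> carrier_mat n n"
    by (simp add: M_def)
  have Mx: "(M *\<^sub>v x) $ k v = (\<Sum>w\<in>V. A v w * x $ k w)"
    if "x \<in> carrier_vec n" "v \<in> V" for x v
  proof -
    have "(M *\<^sub>v x) $ k v = (\<Sum>j\<in>{0..<n}. A v (h j) * x $ k (h j))"
      using that hk[OF that(2)] by (auto simp: M_def scalar_prod_def kh intro!: sum.cong)
    also have "\<dots> = (\<Sum>w\<in>V. A v w * x $ k w)"
      using sum.reindex_bij_betw[OF h, of "\<lambda>w. A v w * x $ k w"] by simp
    finally show ?thesis .
  qed
  \<comment> \<open>Injectivity transfers to the matrix along the enumeration \<open>h\<close> of
    \<open>V\<close>. The nonzero determinant then supplies a right inverse \<open>B\<close>, and
    with it the solution.\<close>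
  have "det M \<noteq> 0"
  proof
    assume "det M = 0"
    then obtain x where x: "x \<in> carrier_vec n" "x \<noteq> 0\<^sub>v n" "M *\<^sub>v x = 0\<^sub>v n"
      using det_0_iff_vec_prod_zero_field[OF M] by blast
    have "\<forall>v\<in>V. x $ k v = 0"
    proof (rule inj)
      fix v assume v: "v \<in> V"
      show "(\<Sum>w\<in>V. A v w * x $ k w) = 0"
        using Mx[OF x(1) v] x(3) hk[OF v] by simp
    qed
    then have "x $ i = 0" if "i < n" for i
      using h that kh[OF that] bij_betwE[OF h] by force
    then have "x = 0\<^sub>v n"
      using x(1) by (intro eq_vecI) auto
    with x(2) show False by simp
  qed
  then have "M \<in> Units (ring_mat TYPE(real) n ())"
    by (rule det_non_zero_imp_unit[OF M])
  then obtain B where B: "B \<in> carrier_mat n n" "M * B = 1\<^sub>m n"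
    unfolding Units_def by (auto simp: ring_mat_def)
  define x where "x = B *\<^sub>v vec n (\<lambda>i. c (h i))"
  have x: "x \<in> carrier_vec n"
    using B(1) by (auto simp: x_def)
  have "M *\<^sub>v x = vec n (\<lambda>i. c (h i))"
    unfolding x_def using B by (simp add: assoc_mult_mat_vec[OF M B(1), symmetric])
  then have "(\<Sum>w\<in>V. A v w * x $ k w) = c v" if "v \<in> V" for v
    using Mx[OF x that] hk[OF that] by simp
  then show thesis
    by (rule that[of "\<lambda>w. x $ k w"])
qed

subsection \<open>The discrete problem at the vertices\<close>

text \<open>Polarised Dirichlet form with vertex terms: each arc contributes the integral of the
  product of the slopes of the affine interpolants of \<open>f\<close> and \<open>g\<close>.\<close>

definition energy ::
  "('v, 'e) pre_digraph \<Rightarrow> ('e \<Rightarrow> real) \<Rightarrow> ('v \<Rightarrow> real) \<Rightarrow> ('v \<Rightarrow> real) \<Rightarrow> ('v \<Rightarrow> real) \<Rightarrow> real" where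
  "energy G len \<alpha> f g =
     (\<Sum>e\<in>arcs G. (f (head G e) - f (tail G e)) * (g (head G e) - g (tail G e)) / len e) +
     (\<Sum>v\<in>verts G. \<alpha> v * f v * g v)"

text \<open>This is the integral over the graph of the edgewise affine interpolant of
  \<open>g\<close>.\<close>

definition load :: "('v, 'e) pre_digraph \<Rightarrow> ('e \<Rightarrow> real) \<Rightarrow> ('v \<Rightarrow> real) \<Rightarrow> real" where
  "load G len g = (\<Sum>e\<in>arcs G. len e * (g (tail G e) + g (head G e)) / 2)"

text \<open>The solution of \<open>- y'' = 1\<close> on \<open>[0, l]\<close> with \<open>y(0) = s\<close> and \<open>y(l) = t\<close>.\<close>

definition edge_torsion :: "real \<Rightarrow> real \<Rightarrow> real \<Rightarrow> real \<Rightarrow> real" where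
  "edge_torsion l s t x = s + (t - s) / l * x + x * (l - x) / 2"

text \<open>The left-hand side of the vertex condition for the torsion function with vertex values \<open>f\<close>.\<close>

definition vertex_defect ::
  "('v, 'e) pre_digraph \<Rightarrow> ('e \<Rightarrow> real) \<Rightarrow> ('v \<Rightarrow> real) \<Rightarrow> ('v \<Rightarrow> real) \<Rightarrow> 'v \<Rightarrow> real" where
  "vertex_defect G len \<alpha> f v =
     (\<Sum>e\<in>{e \<in> arcs G. tail G e = v}. - ((f (head G e) - f (tail G e)) / len e + len e / 2)) +
     (\<Sum>e\<in>{e \<in> arcs G. head G e = v}. (f (head G e) - f (tail G e)) / len e - len e / 2) +
     \<alpha> v * f v"

lemma energy_commute: "energy G len \<alpha> f g = energy G len \<alpha> g f"
  unfolding energy_def by (intro arg_cong2[where f = "(+)"] sum.cong) auto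

lemma energy_diff_self:
  "energy G len \<alpha> (\<lambda>v. f v - g v) (\<lambda>v. f v - g v) =
   energy G len \<alpha> f f - 2 * energy G len \<alpha> f g + energy G len \<alpha> g g"
proof -
  have "((a - b) - (c - d)) * ((a - b) - (c - d)) / l =
      (a - c) * (a - c) / l - 2 * ((a - c) * (b - d) / l) + (b - d) * (b - d) / l"
    for a b c d l :: real
    by (simp add: diff_divide_distrib add_divide_distrib algebra_simps)
  moreover have "a * (b - c) * (b - c) = a * b * b - 2 * (a * b * c) + a * c * c"
    for a b c :: real
    by (simp add: algebra_simps)
  ultimately show ?thesis
    unfolding energy_def
    by (simp only: sum.distrib sum_subtractf sum_distrib_left[symmetric]) simp
qed

context metric_graph
begin

lemma energy_nonneg:
  assumes "\<forall>v\<in>verts G. 0 \<le> \<alpha> v"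
  shows "0 \<le> energy G len \<alpha> f f"
  unfolding energy_def using assms
  by (intro add_nonneg_nonneg sum_nonneg) (auto simp: mult.assoc less_imp_le[OF len_pos])

lemma energy_self_eq_0D:
  assumes \<alpha>: "\<forall>v\<in>verts G. 0 \<le> \<alpha> v" and zero: "energy G len \<alpha> f f = 0"
  shows "e \<in> arcs G \<Longrightarrow> f (tail G e) = f (head G e)"
    and "v \<in> verts G \<Longrightarrow> \<alpha> v \<noteq> 0 \<Longrightarrow> f v = 0"
proof -
  let ?A = "\<lambda>e. (f (head G e) - f (tail G e)) * (f (head G e) - f (tail G e)) / len e"
  let ?B = "\<lambda>v. \<alpha> v * f v * f v"
  have A: "\<And>e. e \<in> arcs G \<Longrightarrow> 0 \<le> ?A e"
    using len_pos by (simp add: less_imp_le)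
  have B: "\<And>v. v \<in> verts G \<Longrightarrow> 0 \<le> ?B v"
    using \<alpha> by (simp add: mult.assoc)
  have "sum ?A (arcs G) = 0" "sum ?B (verts G) = 0"
    using zero sum_nonneg[of "arcs G" ?A, OF A] sum_nonneg[of "verts G" ?B, OF B]
    unfolding energy_def by linarith+
  then have *: "\<And>e. e \<in> arcs G \<Longrightarrow> ?A e = 0" "\<And>v. v \<in> verts G \<Longrightarrow> ?B v = 0"
    using sum_nonneg_eq_0_iff[OF finite_arcs A] sum_nonneg_eq_0_iff[OF finite_verts B] by auto
  show "f (tail G e) = f (head G e)" if "e \<in> arcs G"
    using *(1)[OF that] len_pos[OF that] by simp
  show "f v = 0" if "v \<in> verts G" "\<alpha> v \<noteq> 0"
    using *(2)[OF that(1)] that(2) by simp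
qed

text \<open>Summation by parts: regrouping the vertex sums by arcs pairs the slopes of each arc with
  \<open>g\<close> at its two ends. The difference quotients assemble to the energy, the terms
  \<open>len e / 2\<close> to the load.\<close>

lemma sum_vertex_defect:
  "(\<Sum>v\<in>verts G. vertex_defect G len \<alpha> f v * g v) = energy G len \<alpha> f g - load G len g"
proof -
  have grp: "(\<Sum>v\<in>verts G. (\<Sum>e\<in>{e \<in> arcs G. p e = v}. c e) * g v) = (\<Sum>e\<in>arcs G. c e * g (p e))"
    if "\<And>e. e \<in> arcs G \<Longrightarrow> p e \<in> verts G" for p c
  proof -
    have "(\<Sum>v\<in>verts G. (\<Sum>e\<in>{e \<in> arcs G. p e = v}. c e) * g v) =
        (\<Sum>v\<in>verts G. \<Sum>e\<in>{e \<in> arcs G. p e = v}. c e * g (p e))"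
      by (simp add: sum_distrib_right)
    also have "\<dots> = (\<Sum>e\<in>arcs G. c e * g (p e))"
      using that by (intro sum.group) auto
    finally show ?thesis .
  qed
  have "(\<Sum>v\<in>verts G. vertex_defect G len \<alpha> f v * g v) =
      (\<Sum>e\<in>arcs G. - ((f (head G e) - f (tail G e)) / len e + len e / 2) * g (tail G e)) +
      (\<Sum>e\<in>arcs G. ((f (head G e) - f (tail G e)) / len e - len e / 2) * g (head G e)) +
      (\<Sum>v\<in>verts G. \<alpha> v * f v * g v)"
    unfolding vertex_defect_def distrib_right sum.distrib
    by (subst (1 2) grp) auto
  also have "\<dots> = energy G len \<alpha> f g - load G len g"
  proof -
    have "- (d / l + l / 2) * a + (d / l - l / 2) * b = d * (b - a) / l - l * (a + b) / 2"
      for d l a b :: real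
      by (simp add: algebra_simps add_divide_distrib diff_divide_distrib)
    then have "(\<Sum>e\<in>arcs G. - ((f (head G e) - f (tail G e)) / len e + len e / 2) * g (tail G e)) +
      (\<Sum>e\<in>arcs G. ((f (head G e) - f (tail G e)) / len e - len e / 2) * g (head G e)) =
      (\<Sum>e\<in>arcs G. (f (head G e) - f (tail G e)) * (g (head G e) - g (tail G e)) / len e) -
      load G len g"
      unfolding load_def sum.distrib[symmetric] sum_subtractf[symmetric] by simp
    then show ?thesis
      unfolding energy_def by simp
  qed
  finally show ?thesis .
qed

text \<open>The weak form is equivalent to the vertex conditions; for the converse it is tested with
  the indicator of a single vertex.\<close>

lemma vertex_defect_eq_0_iff:
  "(\<forall>v\<in>verts G. vertex_defect G len \<alpha> f v = 0) \<longleftrightarrow> (\<forall>g. energy G len \<alpha> f g = load G len g)"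
proof
  assume "\<forall>v\<in>verts G. vertex_defect G len \<alpha> f v = 0"
  then show "\<forall>g. energy G len \<alpha> f g = load G len g"
    using sum_vertex_defect[of \<alpha> f] by simp
next
  assume *: "\<forall>g. energy G len \<alpha> f g = load G len g"
  show "\<forall>v\<in>verts G. vertex_defect G len \<alpha> f v = 0"
  proof
    fix v assume "v \<in> verts G"
    then show "vertex_defect G len \<alpha> f v = 0"
      using sum_vertex_defect[of \<alpha> f "\<lambda>w. if w = v then 1 else 0"] * by (simp add: if_distrib sum.delta cong: if_cong)
  qed
qed

text \<open>Linearity in the first argument, with \<open>f\<close> expanded in vertex indicators.
  This presents the energy as a matrix acting on vertex values.\<close>

lemma energy_expand:
  "(\<Sum>w\<in>verts G. energy G len \<alpha> (\<lambda>u. if u = w then 1 else 0) g * f w) = energy G len \<alpha> f g"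
proof -
  let ?\<delta> = "\<lambda>w u. if u = w then 1 else 0 :: real"
  have \<delta>: "(\<Sum>w\<in>verts G. ?\<delta> w u * f w) = f u" if "u \<in> verts G" for u
    using that by (simp add: if_distrib[of "\<lambda>x. x * _"] cong: if_cong)
  have "(\<Sum>w\<in>verts G. energy G len \<alpha> (?\<delta> w) g * f w) =
     (\<Sum>e\<in>arcs G. \<Sum>w\<in>verts G. (?\<delta> w (head G e) - ?\<delta> w (tail G e)) *
        (g (head G e) - g (tail G e)) / len e * f w) +
     (\<Sum>v\<in>verts G. \<Sum>w\<in>verts G. \<alpha> v * ?\<delta> w v * g v * f w)"
    unfolding energy_def distrib_right sum.distrib sum_distrib_right
    by (intro arg_cong2[where f = "(+)"] sum.swap)
  also have "(\<Sum>e\<in>arcs G. \<Sum>w\<in>verts G. (?\<delta> w (head G e) - ?\<delta> w (tail G e)) *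
        (g (head G e) - g (tail G e)) / len e * f w) =
     (\<Sum>e\<in>arcs G. (f (head G e) - f (tail G e)) * (g (head G e) - g (tail G e)) / len e)"
  proof (rule sum.cong[OF refl])
    fix e assume e: "e \<in> arcs G"
    have "(\<Sum>w\<in>verts G. (?\<delta> w (head G e) - ?\<delta> w (tail G e)) *
        (g (head G e) - g (tail G e)) / len e * f w) =
      ((\<Sum>w\<in>verts G. ?\<delta> w (head G e) * f w) - (\<Sum>w\<in>verts G. ?\<delta> w (tail G e) * f w)) *
        ((g (head G e) - g (tail G e)) / len e)"
      unfolding sum_subtractf[symmetric] sum_distrib_right
      by (intro sum.cong) (auto simp: algebra_simps add_divide_distrib diff_divide_distrib)
    then show "(\<Sum>w\<in>verts G. (?\<delta> w (head G e) - ?\<delta> w (tail G e)) *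
        (g (head G e) - g (tail G e)) / len e * f w) =
      (f (head G e) - f (tail G e)) * (g (head G e) - g (tail G e)) / len e"
      unfolding \<delta>[OF head_in_verts[OF e]] \<delta>[OF tail_in_verts[OF e]] by simp
  qed
  also have "(\<Sum>v\<in>verts G. \<Sum>w\<in>verts G. \<alpha> v * ?\<delta> w v * g v * f w) =
      (\<Sum>v\<in>verts G. \<alpha> v * f v * g v)"
  proof (rule sum.cong[OF refl])
    fix v assume v: "v \<in> verts G"
    have "(\<Sum>w\<in>verts G. \<alpha> v * ?\<delta> w v * g v * f w) = \<alpha> v * (\<Sum>w\<in>verts G. ?\<delta> w v * f w) * g v"
      unfolding sum_distrib_left sum_distrib_right by (intro sum.cong) auto
    then show "(\<Sum>w\<in>verts G. \<alpha> v * ?\<delta> w v * g v * f w) = \<alpha> v * f v * g v"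
      unfolding \<delta>[OF v] .
  qed
  finally show ?thesis
    unfolding energy_def .
qed

text \<open>The system matrix is the Gram matrix of the energy on the vertex indicators. A kernel
  vector has zero energy, so definiteness gives injectivity and hence solvability.\<close>

lemma vertex_problem_solvable:
  assumes definite: "\<And>f. energy G len \<alpha> f f = 0 \<Longrightarrow> \<forall>v\<in>verts G. f v = 0"
  obtains f where "\<And>g. energy G len \<alpha> f g = load G len g"
proof -
  let ?\<delta> = "\<lambda>w u. if u = w then 1 else 0 :: real"
  let ?A = "\<lambda>v w. energy G len \<alpha> (?\<delta> w) (?\<delta> v)"
  have inj: "\<forall>v\<in>verts G. f v = 0"
    if zero: "\<And>v. v \<in> verts G \<Longrightarrow> (\<Sum>w\<in>verts G. ?A v w * f w) = 0" for f
  proof (rule definite)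
    have "energy G len \<alpha> (?\<delta> v) f = 0" if v: "v \<in> verts G" for v
      unfolding energy_commute[of _ _ _ "?\<delta> v" f]
      using zero[OF v] energy_expand[of \<alpha> "?\<delta> v" f] by simp
    then show "energy G len \<alpha> f f = 0"
      using energy_expand[of \<alpha> f f] by simp
  qed
  obtain f where f: "\<And>v. v \<in> verts G \<Longrightarrow> (\<Sum>w\<in>verts G. ?A v w * f w) = load G len (?\<delta> v)"
    by (rule linear_system_solvable[where A = ?A and c = "\<lambda>v. load G len (?\<delta> v)",
          OF finite_verts inj]) (assumption, rule that)
  have "\<forall>v\<in>verts G. vertex_defect G len \<alpha> f v = 0"
  proof
    fix v assume v: "v \<in> verts G"
    have "vertex_defect G len \<alpha> f v = (\<Sum>w\<in>verts G. vertex_defect G len \<alpha> f w * ?\<delta> v w)"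
      using v by (simp add: if_distrib cong: if_cong)
    also have "\<dots> = 0"
      unfolding sum_vertex_defect using f[OF v] by (simp add: energy_expand)
    finally show "vertex_defect G len \<alpha> f v = 0" .
  qed
  then show thesis
    using that vertex_defect_eq_0_iff by blast
qed

text \<open>Extending \<open>f\<close> to the inside of each edge by its tail value gives a function
  \<open>F\<close> that is constant on every closed edge. Its level sets are clopen in the quotient
  topology, so connectedness leaves only one.\<close>

lemma connected_mg_imp_const:
  assumes conn: "connected_mg G len" and f: "\<And>e. e \<in> arcs G \<Longrightarrow> f (tail G e) = f (head G e)"
    and vw: "v \<in> verts G" "w \<in> verts G"
  shows "f v = f w"
proof -
  define F where "F p = (case p of Vertex v \<Rightarrow> f v | Inner e x \<Rightarrow> f (tail G e))" for p
  have F: "F (edge_point G len e x) = f (tail G e)" if "e \<in> arcs G" for e x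
    using f[OF that] by (simp add: F_def edge_point_def)
  have op: "openin (gtopology G len) {p \<in> gpoints G len. P (F p)}" for P
    unfolding openin_gtopology
  proof (intro conjI ballI)
    fix e assume e: "e \<in> arcs G"
    then have "{x \<in> {0..len e}. edge_point G len e x \<in> {p \<in> gpoints G len. P (F p)}} =
        (if P (f (tail G e)) then {0..len e} else {})"
      using edge_point_in_gpoints[OF e] by (auto simp: F[OF e])
    then show "openin (top_of_set {0..len e})
        {x \<in> {0..len e}. edge_point G len e x \<in> {p \<in> gpoints G len. P (F p)}}"
      by simp
  qed auto
  let ?U = "{p \<in> gpoints G len. F p = f v}"
  have "connected_space (gtopology G len)"
    using conn by (simp add: connected_mg_def path_connected_imp_connected_space)
  moreover have "openin (gtopology G len) ?U"
    by (rule op)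
  moreover have "closedin (gtopology G len) ?U"
  proof -
    have "gpoints G len - ?U = {p \<in> gpoints G len. F p \<noteq> f v}"
      by auto
    then show ?thesis
      unfolding closedin_def topspace_gtopology using op[of "\<lambda>y. y \<noteq> f v"] by auto
  qed
  ultimately have "?U = {} \<or> ?U = gpoints G len"
    unfolding connected_space_clopen_in topspace_gtopology by blast
  moreover have "Vertex v \<in> ?U" "Vertex w \<in> gpoints G len"
    using vw by (auto simp: gpoints_def F_def)
  ultimately have "Vertex w \<in> ?U"
    by blast
  then show ?thesis
    by (simp add: F_def)
qed

end

subsection \<open>The torsion function\<close>

lemma edge_torsion_has_derivative:
  "(edge_torsion l s t has_real_derivative (t - s) / l + l / 2 - x) (at x within S)"
proof -
  have "((\<lambda>x. s + c * x + x * (l - x) / 2) has_real_derivative c + l / 2 - x) (at x within S)" for c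
    by (auto intro!: derivative_eq_intros simp: field_simps)
  then show ?thesis
    unfolding edge_torsion_def .
qed

lemma continuous_on_edge_torsion: "continuous_on S (edge_torsion l s t)"
  using edge_torsion_has_derivative DERIV_continuous_on by blast

lemma edge_torsion_integral:
  assumes "0 < l"
  shows "(LINT x|lebesgue_on {0..l}. edge_torsion l s t x) = l * (s + t) / 2 + l ^ 3 / 12"
proof -
  let ?F = "\<lambda>x. s * x + (t - s) / l * x\<^sup>2 / 2 + l * x\<^sup>2 / 4 - x ^ 3 / 6"
  have "(edge_torsion l s t has_integral ?F l - ?F 0) {0..l}"
  proof (rule fundamental_theorem_of_calculus)
    have "((\<lambda>x. s * x + c * x\<^sup>2 / 2 + l * x\<^sup>2 / 4 - x ^ 3 / 6) has_real_derivative
        s + c * x + x * (l - x) / 2) (at x within {0..l})" for c x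
      by (auto intro!: derivative_eq_intros simp: field_simps power2_eq_square)
    then show "(?F has_vector_derivative edge_torsion l s t x) (at x within {0..l})" for x
      unfolding has_real_derivative_iff_has_vector_derivative[symmetric] edge_torsion_def .
  qed (use assms in simp)
  then have "integral {0..l} (edge_torsion l s t) = ?F l - ?F 0"
    by (rule integral_unique)
  also have "\<dots> = l * (s + t) / 2 + l ^ 3 / 12"
    using assms by (simp add: field_simps power2_eq_square power3_eq_cube)
  finally show ?thesis
    using lebesgue_integral_eq_integral[OF continuous_imp_integrable_real[OF continuous_on_edge_torsion]]
    by simp
qed

lemma weak_deriv2_edge_torsion:
  assumes "0 < l"
  shows "weak_deriv2 l (edge_torsion l s t) (\<lambda>x. - 1)"
proof -
  have "edge_torsion l s t = (\<lambda>x. s + ((t - s) / l + l / 2) * x - x\<^sup>2 / 2)"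
    by (simp add: fun_eq_iff edge_torsion_def algebra_simps power2_eq_square diff_divide_distrib)
  then show ?thesis
    using weak_deriv2_quadratic[of l s "(t - s) / l + l / 2"] assms by simp
qed

context metric_graph
begin

lemma edge_fun_ends:
  "edge_fun G len u e 0 = u (Vertex (tail G e))"
  "e \<in> arcs G \<Longrightarrow> edge_fun G len u e (len e) = u (Vertex (head G e))"
  using len_pos[of e] by (auto simp: edge_fun_def edge_point_def)

text \<open>Openness in the quotient topology is tested edge by edge, so continuity at the vertices
  is already encoded in the gluing: edges meeting at a vertex share the value of \<open>u\<close>
  there.\<close>

lemma continuous_map_gtopology_iff:
  "continuous_map (gtopology G len) euclideanreal u \<longleftrightarrow>
     (\<forall>e\<in>arcs G. continuous_on {0..len e} (edge_fun G len u e))"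
proof -
  have *: "{x \<in> {0..len e}. edge_point G len e x \<in> {p \<in> gpoints G len. u p \<in> U}} =
      {x \<in> {0..len e}. edge_fun G len u e x \<in> U}" if "e \<in> arcs G" for e U
    using edge_point_in_gpoints[OF that] by (auto simp: edge_fun_def)
  have "continuous_map (gtopology G len) euclideanreal u \<longleftrightarrow>
      (\<forall>U. open U \<longrightarrow> openin (gtopology G len) {p \<in> gpoints G len. u p \<in> U})"
    by (auto simp: continuous_map_def topspace_gtopology)
  also have "\<dots> \<longleftrightarrow> (\<forall>U. open U \<longrightarrow> (\<forall>e\<in>arcs G.
      openin (top_of_set {0..len e}) {x \<in> {0..len e}. edge_fun G len u e x \<in> U}))"
    unfolding openin_gtopology using * by simp
  also have "\<dots> \<longleftrightarrow> (\<forall>e\<in>arcs G. continuous_map (top_of_set {0..len e}) euclideanreal (edge_fun G len u e))"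
    by (auto simp: continuous_map_def)
  finally show ?thesis
    by simp
qed

text \<open>The parabola has derivative slope plus \<open>len e / 2\<close> at 0 and slope minus
  \<open>len e / 2\<close> at the other end; these are the summands of \<open>vertex_defect\<close>
  once the inward sign at 0 is included.\<close>

lemma normal_deriv_sum_edge_torsion:
  assumes u: "\<And>e x. e \<in> arcs G \<Longrightarrow> x \<in> {0..len e} \<Longrightarrow> edge_fun G len u e x =
      edge_torsion (len e) (u (Vertex (tail G e))) (u (Vertex (head G e))) x"
  shows "normal_deriv_sum G len u v + \<alpha> v * u (Vertex v) = vertex_defect G len \<alpha> (\<lambda>w. u (Vertex w)) v"
proof -
  have vd: "vector_derivative (edge_fun G len u e) (at x within {0..len e}) =
      (u (Vertex (head G e)) - u (Vertex (tail G e))) / len e + len e / 2 - x"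
    if e: "e \<in> arcs G" and x: "x \<in> {0..len e}" for e x
  proof (rule vector_derivative_within_closed_interval[OF len_pos[OF e] x])
    show "(edge_fun G len u e has_vector_derivative
        (u (Vertex (head G e)) - u (Vertex (tail G e))) / len e + len e / 2 - x) (at x within {0..len e})"
      by (rule has_vector_derivative_transform[OF x u[OF e]
            edge_torsion_has_derivative[unfolded has_real_derivative_iff_has_vector_derivative]])
  qed
  show ?thesis
    unfolding normal_deriv_sum_def vertex_defect_def
    by (intro arg_cong2[where f = "(+)"] sum.cong refl)
      (auto simp: vd less_imp_le[OF len_pos])
qed

text \<open>The passage from the differential equation to vertex values: continuity and the weak
  equation together amount to an explicit parabola on each edge, so only the vertex conditions
  remain.\<close>

lemma neg_laplacian_eq_one_iff:
  "neg_laplacian_eq G len \<alpha> u (\<lambda>_. 1) \<longleftrightarrow>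
     (\<forall>e\<in>arcs G. \<forall>x\<in>{0..len e}. edge_fun G len u e x =
        edge_torsion (len e) (u (Vertex (tail G e))) (u (Vertex (head G e))) x) \<and>
     (\<forall>v\<in>verts G. vertex_defect G len \<alpha> (\<lambda>w. u (Vertex w)) v = 0)"
  (is "?L \<longleftrightarrow> ?Q \<and> ?K")
proof -
  have L: "?L \<longleftrightarrow> (\<forall>e\<in>arcs G. continuous_on {0..len e} (edge_fun G len u e)) \<and>
      (\<forall>e\<in>arcs G. weak_deriv2 (len e) (edge_fun G len u e) (\<lambda>x. - 1)) \<and>
      (\<forall>v\<in>verts G. normal_deriv_sum G len u v + \<alpha> v * u (Vertex v) = 0)"
    unfolding neg_laplacian_eq_def laplacian_dom_def H2_def continuous_map_gtopology_iff
    by (auto simp: edge_fun_def)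
  show ?thesis
  proof
    assume ?L
    have Q: ?Q
    proof (intro ballI)
      fix e x assume e: "e \<in> arcs G" and x: "x \<in> {0..len e}"
      show "edge_fun G len u e x =
        edge_torsion (len e) (u (Vertex (tail G e))) (u (Vertex (head G e))) x"
        using weak_deriv2_imp_quadratic[OF len_pos[OF e] _ _ x, of "edge_fun G len u e"] \<open>?L\<close> e
        unfolding L edge_torsion_def edge_fun_ends(1) edge_fun_ends(2)[OF e] by blast
    qed
    moreover have ?K
      using \<open>?L\<close> normal_deriv_sum_edge_torsion[of u _ \<alpha>] Q unfolding L by simp
    ultimately show "?Q \<and> ?K" ..
  next
    assume *: "?Q \<and> ?K"
    have "continuous_on {0..len e} (edge_fun G len u e)" if "e \<in> arcs G" for e
      using continuous_on_cong[OF refl, THEN iffD2, OF _ continuous_on_edge_torsion] * that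
      by blast
    moreover have "weak_deriv2 (len e) (edge_fun G len u e) (\<lambda>x. - 1)" if e: "e \<in> arcs G" for e
      using * e by (intro weak_deriv2_cong[THEN iffD2, OF _ refl weak_deriv2_edge_torsion[OF len_pos[OF e]]]) auto
    moreover have "\<forall>v\<in>verts G. normal_deriv_sum G len u v + \<alpha> v * u (Vertex v) = 0"
      using normal_deriv_sum_edge_torsion[of u _ \<alpha>] * by simp
    ultimately show ?L
      unfolding L by blast
  qed
qed

text \<open>As \<open>torsion_function\<close> is a definite description, both existence and
  uniqueness are established. The parabolas built from \<open>f\<close> give existence;
  definiteness, applied to the difference of vertex values, gives uniqueness.\<close>

lemma torsion_function_eq:
  assumes definite: "\<And>f. energy G len \<alpha> f f = 0 \<Longrightarrow> \<forall>v\<in>verts G. f v = 0"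
    and f: "\<And>g. energy G len \<alpha> f g = load G len g"
    and e: "e \<in> arcs G" and x: "x \<in> {0..len e}"
  shows "edge_fun G len (torsion_function G len \<alpha>) e x =
    edge_torsion (len e) (f (tail G e)) (f (head G e)) x"
proof -
  define u where "u = restrict (\<lambda>p. case p of Vertex v \<Rightarrow> f v
      | Inner e x \<Rightarrow> edge_torsion (len e) (f (tail G e)) (f (head G e)) x) (gpoints G len)"
  have u_vert: "u (Vertex v) = f v" if "v \<in> verts G" for v
    using that by (simp add: u_def gpoints_def)
  have u_edge: "edge_fun G len u e x = edge_torsion (len e) (f (tail G e)) (f (head G e)) x"
    if e: "e \<in> arcs G" and x: "x \<in> {0..len e}" for e x
  proof -
    consider "x = 0" | "x = len e" | "0 < x" "x < len e"
      using x by force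
    then show ?thesis
    proof cases
      case 3
      then show ?thesis
        using e by (simp add: u_def edge_fun_def edge_point_def gpoints_def)
    qed (use len_pos[OF e] e in \<open>auto simp: edge_fun_ends u_vert edge_torsion_def\<close>)
  qed
  have "neg_laplacian_eq G len \<alpha> u (\<lambda>_. 1)"
    unfolding neg_laplacian_eq_one_iff
  proof
    have "\<forall>v\<in>verts G. vertex_defect G len \<alpha> f v = 0"
      using f vertex_defect_eq_0_iff by blast
    moreover have "vertex_defect G len \<alpha> (\<lambda>w. u (Vertex w)) v = vertex_defect G len \<alpha> f v"
      if "v \<in> verts G" for v
      unfolding vertex_defect_def using that
      by (intro arg_cong2[where f = "(+)"] sum.cong refl) (auto simp: u_vert)
    ultimately show "\<forall>v\<in>verts G. vertex_defect G len \<alpha> (\<lambda>w. u (Vertex w)) v = 0"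
      by simp
  qed (simp add: u_edge u_vert)
  moreover have "w = u"
    if w: "w \<in> extensional (gpoints G len)" "neg_laplacian_eq G len \<alpha> w (\<lambda>_. 1)" for w
  proof -
    define g where "g v = w (Vertex v)" for v
    have w_edge: "edge_fun G len w e x = edge_torsion (len e) (g (tail G e)) (g (head G e)) x"
      if "e \<in> arcs G" "x \<in> {0..len e}" for e x
      using w(2) that unfolding neg_laplacian_eq_one_iff g_def by blast
    have g: "energy G len \<alpha> g h = load G len h" for h
      using w(2) vertex_defect_eq_0_iff[of \<alpha> g] unfolding neg_laplacian_eq_one_iff g_def by blast
    \<comment> \<open>The weak forms tested with both solutions give \<open>E(g, g) = b(g)\<close>,
      \<open>E(g, f) = E(f, f) = b(f)\<close> and \<open>E(f, g) = b(g)\<close>. Symmetry yields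
      \<open>b(f) = b(g)\<close>, and the expanded square cancels.\<close>
    have "energy G len \<alpha> (\<lambda>v. g v - f v) (\<lambda>v. g v - f v) = 0"
      using energy_diff_self[of G len \<alpha> g f] g[of g] g[of f] f[of f] f[of g]
        energy_commute[of G len \<alpha> f g] by simp
    then have gf: "g v = f v" if "v \<in> verts G" for v
      using definite that by force
    show "w = u"
    proof (rule extensionalityI)
      show "w \<in> extensional (gpoints G len)" "u \<in> extensional (gpoints G len)"
        using w by (auto simp: u_def)
      fix p assume "p \<in> gpoints G len"
      then consider v where "p = Vertex v" "v \<in> verts G"
        | e x where "p = Inner e x" "e \<in> arcs G" "0 < x" "x < len e"
        by (auto simp: gpoints_def)
      then show "w p = u p"
      proof cases
        case 1
        then show ?thesis using gf u_vert by (simp add: g_def)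
      next
        case 2
        then show ?thesis
          using w_edge[of e x] u_edge[of e x] gf
          by (simp add: edge_fun_def edge_point_def)
      qed
    qed
  qed
  ultimately have "torsion_function G len \<alpha> = u"
    unfolding torsion_function_def by (intro the_equality) (auto simp: u_def)
  then show ?thesis
    using u_edge[OF e x] by simp
qed

text \<open>The cubic sum collects the integrals of \<open>x * (len e - x) / 2\<close>, the part of
  the torsion function independent of the vertex values; the affine parts integrate to the
  load.\<close>

lemma torsional_rigidity_eq:
  assumes definite: "\<And>f. energy G len \<alpha> f f = 0 \<Longrightarrow> \<forall>v\<in>verts G. f v = 0"
  obtains f where "\<And>g. energy G len \<alpha> f g = load G len g"
    and "torsional_rigidity G len \<alpha> = load G len f + (\<Sum>e\<in>arcs G. len e ^ 3 / 12)"
proof -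
  obtain f where f: "\<And>g. energy G len \<alpha> f g = load G len g"
    using vertex_problem_solvable[OF definite] by blast
  have "torsional_rigidity G len \<alpha> =
      (\<Sum>e\<in>arcs G. LINT x|lebesgue_on {0..len e}. edge_torsion (len e) (f (tail G e)) (f (head G e)) x)"
    unfolding torsional_rigidity_def graph_integral_def
    by (intro sum.cong refl Bochner_Integration.integral_cong)
      (simp add: torsion_function_eq[OF definite f])
  also have "\<dots> = load G len f + (\<Sum>e\<in>arcs G. len e ^ 3 / 12)"
    unfolding load_def sum.distrib[symmetric]
    by (intro sum.cong refl edge_torsion_integral len_pos)
  finally show thesis
    using that f by blast
qed

end

section \<open>Comparison of the two graphs\<close>

theorem theorem7p1:
  fixes G :: "('v, 'e) pre_digraph"
    and len len' :: "'e \<Rightarrow> real"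
    and \<alpha> :: "'v \<Rightarrow> real"
    and e\<^sub>0 :: 'e
  assumes "metric_graph G len"
    and "connected_mg G len"
    and "\<forall>v\<in>verts G. 0 \<le> \<alpha> v"
    and "\<exists>v\<in>verts G. \<alpha> v \<noteq> 0"
    and "e\<^sub>0 \<in> arcs G"
    and "\<forall>e\<in>arcs G. e \<noteq> e\<^sub>0 \<longrightarrow> len' e = len e"
    and "len e\<^sub>0 < len' e\<^sub>0"
  shows "torsional_rigidity G len \<alpha> < torsional_rigidity G len' \<alpha>"
proof -
  interpret M: metric_graph G len by fact
  have len_le: "len e \<le> len' e" if "e \<in> arcs G" for e
    using assms(6,7) that by (cases "e = e\<^sub>0") auto
  interpret M': metric_graph G len'
  proof
    show "0 < len' e" if "e \<in> arcs G" for e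
      using M.len_pos[OF that] len_le[OF that] by linarith
  qed
  \<comment> \<open>Connectedness is given for \<open>len\<close> only. Zero energy forces equal
    values at the two ends of each arc, a condition free of lengths, so the same connectedness
    serves for every length function \<open>l\<close>.\<close>
  have definite: "\<forall>v\<in>verts G. f v = 0"
    if "metric_graph G l" "energy G l \<alpha> f f = 0" for l and f :: "'v \<Rightarrow> real"
  proof
    interpret L: metric_graph G l by fact
    fix v assume "v \<in> verts G"
    obtain w where "w \<in> verts G" "\<alpha> w \<noteq> 0"
      using assms(4) by blast
    then show "f v = 0"
      using M.connected_mg_imp_const[OF assms(2) L.energy_self_eq_0D(1)[OF assms(3) that(2)]]
        L.energy_self_eq_0D(2)[OF assms(3) that(2)] \<open>v \<in> verts G\<close> by metis
  qed
  obtain f where f: "\<And>g. energy G len \<alpha> f g = load G len g"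
    and T: "torsional_rigidity G len \<alpha> = load G len f + (\<Sum>e\<in>arcs G. len e ^ 3 / 12)"
    using M.torsional_rigidity_eq[OF definite[OF M.metric_graph_axioms]] by metis
  obtain f' where f': "\<And>g. energy G len' \<alpha> f' g = load G len' g"
    and T': "torsional_rigidity G len' \<alpha> = load G len' f' + (\<Sum>e\<in>arcs G. len' e ^ 3 / 12)"
    using M'.torsional_rigidity_eq[OF definite[OF M'.metric_graph_axioms]] by metis
  define g where "g v = \<bar>f v\<bar>" for v
  have "load G len f \<le> load G len' g"
    unfolding load_def
  proof (rule sum_mono)
    fix e assume e: "e \<in> arcs G"
    have "len e * (f (tail G e) + f (head G e)) \<le> len e * (g (tail G e) + g (head G e))"
      using M.len_pos[OF e] by (intro mult_left_mono) (auto simp: g_def)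
    also have "\<dots> \<le> len' e * (g (tail G e) + g (head G e))"
      using len_le[OF e] by (intro mult_right_mono) (auto simp: g_def)
    finally show "len e * (f (tail G e) + f (head G e)) / 2 \<le> len' e * (g (tail G e) + g (head G e)) / 2"
      by simp
  qed
  \<comment> \<open>Absolute values shrink differences, and the longer edge has the larger
    denominator; the vertex terms are unchanged because \<open>g\<close> and \<open>f\<close> have
    equal squares.\<close>
  moreover have "energy G len' \<alpha> g g \<le> energy G len \<alpha> f f"
    unfolding energy_def
  proof (intro add_mono sum_mono)
    fix e assume e: "e \<in> arcs G"
    have "\<bar>g (head G e) - g (tail G e)\<bar> \<le> \<bar>f (head G e) - f (tail G e)\<bar>"
      by (simp add: g_def abs_triangle_ineq3)
    then have "(g (head G e) - g (tail G e)) * (g (head G e) - g (tail G e)) \<le>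
        (f (head G e) - f (tail G e)) * (f (head G e) - f (tail G e))"
      unfolding abs_le_square_iff power2_eq_square .
    then show "(g (head G e) - g (tail G e)) * (g (head G e) - g (tail G e)) / len' e \<le>
        (f (head G e) - f (tail G e)) * (f (head G e) - f (tail G e)) / len e"
      using M.len_pos[OF e] len_le[OF e] by (intro frac_le) auto
  qed (simp add: g_def mult.assoc)
  \<comment> \<open>Expanding the square gives \<open>b'(f') \<ge> 2 b'(g) - E'(g, g)\<close>, the
    maximality of \<open>b'(f')\<close>. By the two preceding estimates the right side is at least
    \<open>2 b(f) - E(f, f) = b(f)\<close>.\<close>
  moreover have "0 \<le> energy G len' \<alpha> (\<lambda>v. f' v - g v) (\<lambda>v. f' v - g v)"
    using M'.energy_nonneg[OF assms(3)] .
  ultimately have "load G len f \<le> load G len' f'"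
    unfolding energy_diff_self f f' by linarith
  moreover have "(\<Sum>e\<in>arcs G. len e ^ 3 / 12) < (\<Sum>e\<in>arcs G. len' e ^ 3 / 12)"
  proof (rule sum_strict_mono_ex1[OF M.finite_arcs])
    show "\<forall>e\<in>arcs G. len e ^ 3 / 12 \<le> len' e ^ 3 / 12"
      using M.len_pos len_le by (simp add: power_mono less_imp_le)
    show "\<exists>e\<in>arcs G. len e ^ 3 / 12 < len' e ^ 3 / 12"
      using assms(5,7) M.len_pos[OF assms(5)] by (auto intro!: bexI[of _ "e\<^sub>0"] power_strict_mono)
  qed
  ultimately show ?thesis
    unfolding T T' by linarith
qed

end
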